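(* Let $\alpha$ be a complex number with $|2\alpha - 1| \leq 1$. If $f \in \mathcal{A}$ is a convex function, then the function $$z \mapsto \alpha f(z) + (1-\alpha) z f'(z)$$ is univalent in $\mathbb{D}$.
   Context: $\mathbb{D} = \{z \in \mathbb{C} : |z| < 1\}$. $\mathcal{A}$ denotes the class of functions $f$ analytic on $\mathbb{D}$ with $f(0) = 0$ and $f'(0) = 1$. A function is univalent in $\mathbb{D}$ if it is analytic and injective there. A function $f \in \mathcal{A}$ is called convex if $f$ is univalent in $\mathbb{D}$ and $f(\mathbb{D})$ is a convex domain. *)

theory Defs
  imports "HOL-Complex_Analysis.Complex_Analysis"
begin

text \<open>
  Functions on the unit disc are total functions on the complex plane, of which only the values
  on the disc matter; the disc is open, so \<^term>\<open>deriv\<close> at its points depends on those values only.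
\<close>

abbreviation unit_disc :: "complex set" where
  "unit_disc \<equiv> ball 0 1"

definition class_A :: "(complex \<Rightarrow> complex) set" where
  "class_A = {f. f analytic_on unit_disc \<and> f 0 = 0 \<and> deriv f 0 = 1}"

definition univalent_on :: "(complex \<Rightarrow> complex) \<Rightarrow> complex set \<Rightarrow> bool" where
  "univalent_on f S \<longleftrightarrow> f analytic_on S \<and> inj_on f S"

definition complex_domain :: "complex set \<Rightarrow> bool" where
  "complex_domain S \<longleftrightarrow> open S \<and> connected S \<and> S \<noteq> {}"

definition convex_function :: "(complex \<Rightarrow> complex) \<Rightarrow> bool" where
  "convex_function f \<longleftrightarrow>
     f \<in> class_A \<and> univalent_on f unit_disc \<and>
     complex_domain (f ` unit_disc) \<and> convex (f ` unit_disc)"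

end

theory Submission
  imports Defs
begin

text \<open>
  Write \<open>D\<close> for the unit disc, put \<open>p z = 1 + z f''(z) / f'(z)\<close> and let \<open>F = \<alpha> f + (1 - \<alpha>) z f'\<close>. For
  \<open>\<alpha> \<noteq> 1\<close>,
  \<open>F' / ((1 - \<alpha>) f') = \<alpha> / (1 - \<alpha>) + p\<close>.
  The disc \<open>\<bar>2\<alpha> - 1\<bar> \<le> 1\<close> is exactly where the first summand has nonnegative real part (the point
  \<open>\<alpha> = 1\<close> aside), and convexity of \<open>f\<close> makes the real part of \<open>p\<close> positive. Hence \<open>F\<close> is
  close-to-convex with respect to \<open>(1 - \<alpha>) f\<close>: transplanted to the convex domain
  \<open>f(D)\<close>, that is, composed with the inverse of \<open>f\<close>, the function \<open>F / (1 - \<alpha>)\<close> has a derivative with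
  positive real part, so it cannot take the same value at both ends of a segment
  (lemma \<open>inj_on_if_Re_deriv_quotient_pos\<close>). For \<open>\<alpha> = 1\<close> the function is \<open>f\<close> itself.

  The positivity of \<open>Re p\<close> (lemma \<open>Re_convexity_quotient_pos\<close>) comes from Schwarz's lemma, applied to
  the self-maps \<open>w \<mapsto> f\<^sup>-\<^sup>1 ((1 - t) f(w) + t f(u w))\<close> of the disc, which exist because \<open>f(D)\<close> is
  convex. To first order in \<open>t\<close> it says
  \<open>Re ((f(z) - f(u z)) / (z f'(z))) \<ge> 0\<close> for \<open>\<bar>u\<bar> \<le> 1\<close> (lemma \<open>Re_chord_quotient_nonneg\<close>). Along
  \<open>u = exp (i t)\<close> the left side has a minimum, namely 0, at \<open>t = 0\<close>, and its second derivative there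
  is \<open>Re p(z)\<close>. So \<open>Re p \<ge> 0\<close>, and the open mapping theorem makes the inequality strict, since
  \<open>p(0) = 1\<close>.
\<close>

section \<open>Holomorphic functions and positive real parts\<close>

lemma has_real_derivative_Re_of_real:
  assumes "(H has_field_derivative D) (at (complex_of_real t))"
  shows "((\<lambda>x. Re (H (complex_of_real x))) has_real_derivative Re D) (at t)"
  using has_vector_derivative_real_field[OF assms] by (rule has_field_derivative_Re)

text \<open>
  A minimum principle: a zero of the real part would, by openness of the image, have points with
  negative real part near its value, unless \<^term>\<open>Q\<close> is constant.
\<close>
lemma Re_pos_if_Re_nonneg:
  assumes holQ: "Q holomorphic_on S" and S: "open S" "connected S"
    and nonneg: "\<And>z. z \<in> S \<Longrightarrow> Re (Q z) \<ge> 0"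
    and a: "a \<in> S" "Re (Q a) > 0" and z: "z \<in> S"
  shows "Re (Q z) > 0"
proof (cases "Q constant_on S")
  case True
  then obtain c where "\<And>w. w \<in> S \<Longrightarrow> Q w = c"
    by (auto simp: constant_on_def)
  then show ?thesis using a z by simp
next
  case False
  have "open (Q ` S)"
    using open_mapping_thm[OF holQ S S(1) order_refl False] .
  then obtain e where e: "e > 0" "ball (Q z) e \<subseteq> Q ` S"
    using z unfolding open_contains_ball by blast
  have "Q z - of_real (e / 2) \<in> ball (Q z) e"
    using e(1) unfolding mem_ball dist_norm by (simp del: of_real_divide)
  with e(2) have "Q z - of_real (e / 2) \<in> Q ` S" by (rule subsetD)
  then obtain w where w: "Q z - of_real (e / 2) = Q w" "w \<in> S" by (rule imageE)
  have "Re (Q w) = Re (Q z) - e / 2" by (simp flip: w(1))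
  with nonneg[OF w(2)] e(1) show ?thesis by linarith
qed

text \<open>
  The univalence criterion of Noshiro and Warschawski in its close-to-convex form, due to Kaplan: on
  the convex set \<^term>\<open>f ` S\<close> the function \<open>F \<circ> f\<^sup>-\<^sup>1\<close> has derivative \<open>F' / f'\<close>, so on the segment from
  \<open>f z\<^sub>1\<close> to \<open>f z\<^sub>2\<close> its real part, measured in the direction of the segment, is strictly increasing.
\<close>
lemma inj_on_if_Re_deriv_quotient_pos:
  assumes holf: "f holomorphic_on S" and holF: "F holomorphic_on S" and S: "open S"
    and inj: "inj_on f S" and conv: "convex (f ` S)"
    and pos: "\<And>z. z \<in> S \<Longrightarrow> Re (deriv F z / deriv f z) > 0"
  shows "inj_on F S"
proof (rule inj_onI, rule ccontr)
  fix z1 z2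
  assume z: "z1 \<in> S" "z2 \<in> S" and eq: "F z1 = F z2" and ne: "z1 \<noteq> z2"
  obtain g where g: "g holomorphic_on (f ` S)"
    "\<And>z. z \<in> S \<Longrightarrow> deriv f z * deriv g (f z) = 1" "\<And>z. z \<in> S \<Longrightarrow> g (f z) = z"
    using holomorphic_has_inverse[OF holf S inj] by metis
  have openf: "open (f ` S)" by (rule open_mapping_thm3[OF holf S inj])
  define d where "d = f z2 - f z1"
  have d: "d \<noteq> 0" using z ne inj by (auto simp: d_def inj_on_def)
  \<comment> \<open>Dividing by the direction \<open>d\<close> cancels the factor \<open>d\<close> of the chain rule, so \<open>H' = F' / f'\<close>.\<close>
  define H where "H = (\<lambda>t. F (g (f z1 + t * d)) / d)"
  have "Re (H (of_real 0)) < Re (H (of_real 1))"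
  proof (rule DERIV_pos_imp_increasing[where f = "\<lambda>t. Re (H (of_real t))"])
    fix t :: real assume t: "0 \<le> t" "t \<le> 1"
    have "(1 - t) *\<^sub>R f z1 + t *\<^sub>R f z2 \<in> f ` S"
      using t z conv by (intro convexD) auto
    moreover have "(1 - t) *\<^sub>R f z1 + t *\<^sub>R f z2 = f z1 + of_real t * d"
      by (simp add: d_def scaleR_conv_of_real algebra_simps)
    ultimately obtain w where w: "w \<in> S" "f z1 + of_real t * d = f w" by auto
    have dg: "(g has_field_derivative deriv g (f w)) (at (f w))"
      using g(1) openf w(1) by (auto intro: holomorphic_derivI)
    have dF: "(F has_field_derivative deriv F w) (at (g (f w)))"
      using holF S w(1) g(3) by (auto intro: holomorphic_derivI)
    have dl: "((\<lambda>t. f z1 + t * d) has_field_derivative d) (at (of_real t))"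
      by (auto intro!: derivative_eq_intros)
    have "((\<lambda>t. F (g (f z1 + t * d)) / d) has_field_derivative
        deriv F w * (deriv g (f w) * d) / d) (at (of_real t))"
      using DERIV_chain2[OF _ DERIV_chain2[OF _ dl], of F _ g] dF dg
      by (intro DERIV_cdivide) (simp add: w(2))
    moreover have "deriv F w * (deriv g (f w) * d) / d = deriv F w / deriv f w"
    proof -
      have "deriv f w \<noteq> 0" using g(2)[OF w(1)] by auto
      then show ?thesis using d g(2)[OF w(1)] by (simp add: field_simps)
    qed
    ultimately have "(H has_field_derivative deriv F w / deriv f w) (at (of_real t))"
      by (simp add: H_def)
    from has_real_derivative_Re_of_real[OF this] pos[OF w(1)]
    show "\<exists>y. ((\<lambda>t. Re (H (complex_of_real t))) has_real_derivative y) (at t) \<and> 0 < y"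
      by blast
  qed simp
  moreover have "H (of_real 0) = H (of_real 1)"
    using z g(3) eq by (simp add: H_def d_def)
  ultimately show False by simp
qed

section \<open>Convex univalent functions on the disc\<close>

text \<open>
  The maps \<open>w \<mapsto> f\<^sup>-\<^sup>1 ((1 - t) f(w) + t f(u w))\<close>, for \<open>0 \<le> t \<le> 1\<close>, send the disc into itself and fix 0,
  so by Schwarz's lemma they do not move \<open>z\<close> away from the origin. At \<open>t = 0\<close> the image of \<open>z\<close> is \<open>z\<close>,
  and its velocity \<open>(f(u z) - f(z)) / f'(z)\<close> therefore cannot have a positive component in the direction of
  \<open>z\<close>.
\<close>
lemma Re_chord_quotient_nonneg:
  assumes holf: "f holomorphic_on unit_disc" and inj: "inj_on f unit_disc"
    and conv: "convex (f ` unit_disc)" and z: "norm z < 1" and u: "norm u \<le> 1"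
  shows "Re ((f z - f (u * z)) / (z * deriv f z)) \<ge> 0"
proof (rule ccontr)
  assume contr: "\<not> ?thesis"
  hence z0: "z \<noteq> 0" by auto
  have f': "deriv f z \<noteq> 0"
    using holomorphic_injective_imp_regular[OF holf open_ball inj] z by simp
  obtain g where g: "g holomorphic_on (f ` unit_disc)"
    "\<And>z. z \<in> unit_disc \<Longrightarrow> deriv f z * deriv g (f z) = 1"
    "\<And>z. z \<in> unit_disc \<Longrightarrow> g (f z) = z"
    using holomorphic_has_inverse[OF holf open_ball inj] by metis
  have openf: "open (f ` unit_disc)" by (rule open_mapping_thm3[OF holf open_ball inj])
  have u_disc: "u * w \<in> unit_disc" if "norm w < 1" for w
    using that u mult_right_mono[of "norm u" 1 "norm w"] by (simp add: norm_mult)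
  define \<phi> where "\<phi> = (\<lambda>t w. g (f w + t * (f (u * w) - f w)))"
  have chord: "f w + of_real t * (f (u * w) - f w) \<in> f ` unit_disc"
    if "0 \<le> t" "t \<le> 1" "norm w < 1" for t :: real and w
  proof -
    have "(1 - t) *\<^sub>R f w + t *\<^sub>R f (u * w) \<in> f ` unit_disc"
      using that u_disc[of w] conv by (intro convexD) auto
    moreover have "(1 - t) *\<^sub>R f w + t *\<^sub>R f (u * w) = f w + of_real t * (f (u * w) - f w)"
      by (simp add: scaleR_conv_of_real algebra_simps)
    ultimately show ?thesis by simp
  qed
  have schwarz: "norm (\<phi> (of_real t) z) \<le> norm z" if t: "0 \<le> t" "t \<le> 1" for t :: real
  proof (rule Schwarz_Lemma(1)[OF _ _ _ z])
    have "(\<lambda>w. f (u * w)) holomorphic_on unit_disc"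
      using u_disc by (intro holomorphic_on_compose_gen[OF _ holf, unfolded o_def]
        holomorphic_intros image_subsetI) simp
    then have "(\<lambda>w. f w + of_real t * (f (u * w) - f w)) holomorphic_on unit_disc"
      using holf by (intro holomorphic_intros)
    then show "\<phi> (of_real t) holomorphic_on ball 0 1"
      unfolding \<phi>_def using chord[OF t]
      by (intro holomorphic_on_compose_gen[OF _ g(1), unfolded o_def] image_subsetI) simp_all
    show "\<phi> (of_real t) 0 = 0" using g(3)[of 0] by (simp add: \<phi>_def)
    fix w :: complex assume "norm w < 1"
    from chord[OF t this] show "norm (\<phi> (of_real t) w) < 1"
      using g(3) by (auto simp: \<phi>_def)
  qed
  \<comment> \<open>The derivative of \<open>\<phi> t z\<close> at \<open>t = 0\<close>, times \<open>cnj z\<close> so that its real part is the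
    radial component.\<close>
  define D where "D = cnj z * ((f (u * z) - f z) / deriv f z)"
  have "((\<lambda>t. cnj z * \<phi> t z) has_field_derivative D) (at (of_real 0))"
  proof -
    have dg: "(g has_field_derivative deriv g (f z)) (at (f z))"
      using g(1) openf z by (auto intro: holomorphic_derivI)
    have dl: "((\<lambda>t. f z + t * (f (u * z) - f z)) has_field_derivative f (u * z) - f z)
        (at (of_real 0))"
      by (auto intro!: derivative_eq_intros)
    have "((\<lambda>t. g (f z + t * (f (u * z) - f z))) has_field_derivative
        deriv g (f z) * (f (u * z) - f z)) (at (of_real 0))"
      by (rule DERIV_chain2[OF _ dl]) (use dg in simp)
    from DERIV_cmult[OF this, of "cnj z"] show ?thesis
      using g(2)[of z] z unfolding \<phi>_def D_def
      by (metis (no_types, lifting) dist_0_norm divide_inverse_commute inverse_unique mem_ball)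
  qed
  from has_real_derivative_Re_of_real[OF this]
  have der: "((\<lambda>t. Re (cnj z * \<phi> (of_real t) z)) has_real_derivative Re D) (at 0)" .
  have "D = - (of_real ((norm z)\<^sup>2) * ((f z - f (u * z)) / (z * deriv f z)))"
    unfolding D_def complex_norm_square using z0 f' by (simp add: field_simps)
  then have "Re D = - ((norm z)\<^sup>2 * Re ((f z - f (u * z)) / (z * deriv f z)))"
    by (simp only: uminus_complex.sel times_complex.sel Re_complex_of_real Im_complex_of_real)
  then have "Re D > 0"
    using contr z0 by (simp add: mult_pos_neg)
  from DERIV_pos_inc_right[OF der this] obtain e where e: "e > 0"
    "\<And>h. 0 < h \<Longrightarrow> h < e \<Longrightarrow> Re (cnj z * \<phi> 0 z) < Re (cnj z * \<phi> (of_real h) z)"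
    by auto
  define h where "h = min (e / 2) 1"
  have h: "0 < h" "h < e" "h \<le> 1" using e(1) by (auto simp: h_def)
  have "(norm z)\<^sup>2 = Re (cnj z * \<phi> 0 z)"
    using g(3)[of z] z by (simp add: \<phi>_def cmod_power2) (simp add: power2_eq_square)
  also have "\<dots> < Re (cnj z * \<phi> (of_real h) z)" using e(2) h by blast
  also have "\<dots> \<le> norm z * norm (\<phi> (of_real h) z)"
    using complex_Re_le_cmod[of "cnj z * \<phi> (of_real h) z"] by (simp add: norm_mult)
  also have "\<dots> \<le> norm z * norm z"
    using schwarz[of h] h by (intro mult_left_mono) auto
  finally show False by (simp add: power2_eq_square)
qed

text \<open>
  Necessary second-order condition for the minimum at \<open>t = 0\<close> of the real part of
  \<open>\<psi> t = (f(z) - f(exp (i t) z)) / (z f'(z))\<close>. The first derivative \<open>- i exp (i t) f'(exp (i t) z) / f'(z)\<close>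
  is imaginary at 0, and the second derivative at 0 is \<open>1 + z f''(z) / f'(z)\<close>; were its real
  part negative, \<open>Re \<psi>\<close> would fall below its value 0 at \<open>t = 0\<close>.
\<close>
lemma Re_convexity_quotient_nonneg:
  assumes holf: "f holomorphic_on unit_disc" and inj: "inj_on f unit_disc"
    and conv: "convex (f ` unit_disc)" and z: "norm z < 1"
  shows "Re (1 + z * deriv (deriv f) z / deriv f z) \<ge> 0"
proof (rule ccontr)
  assume "\<not> ?thesis"
  hence neg: "Re (1 + z * deriv (deriv f) z / deriv f z) < 0" by simp
  hence z0: "z \<noteq> 0" by auto
  have f': "deriv f z \<noteq> 0"
    using holomorphic_injective_imp_regular[OF holf open_ball inj] z by simp
  define c where "c = (\<lambda>t. exp (\<i> * t))"
  have c_disc: "c (of_real t) * z \<in> unit_disc" for t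
    using z by (simp add: c_def norm_mult)
  have dc: "((\<lambda>t. c t * z) has_field_derivative \<i> * c t * z) (at t)" for t
    unfolding c_def by (auto intro!: derivative_eq_intros)
  define \<psi> where "\<psi> = (\<lambda>t. (f z - f (c t * z)) / (z * deriv f z))"
  define \<psi>' where "\<psi>' = (\<lambda>t. - \<i> * c t * deriv f (c t * z) / deriv f z)"
  have d1: "((\<lambda>t. Re (\<psi> (of_real t))) has_real_derivative Re (\<psi>' (of_real t))) (at t)" for t
  proof (rule has_real_derivative_Re_of_real)
    have df: "(f has_field_derivative deriv f (c t * z)) (at (c t * z))"
      using holf c_disc by (auto intro: holomorphic_derivI)
    have "((\<lambda>t. f (c t * z)) has_field_derivative
        deriv f (c t * z) * (\<i> * c t * z)) (at (of_real t))"
      by (rule DERIV_chain2[OF df dc])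
    then show "(\<psi> has_field_derivative \<psi>' (of_real t)) (at (of_real t))"
      unfolding \<psi>_def using z0 f'
      by (auto intro!: derivative_eq_intros simp: \<psi>'_def field_simps)
  qed
  have d2: "((\<lambda>t. Re (\<psi>' (of_real t))) has_real_derivative
      Re (1 + z * deriv (deriv f) z / deriv f z)) (at 0)"
  proof (rule has_real_derivative_Re_of_real)
    have hol': "deriv f holomorphic_on unit_disc"
      using holf by (simp add: holomorphic_deriv)
    have df: "(deriv f has_field_derivative deriv (deriv f) z) (at (c 0 * z))"
      using hol' z by (auto intro: holomorphic_derivI simp: c_def)
    have "((\<lambda>t. deriv f (c t * z)) has_field_derivative
        deriv (deriv f) z * (\<i> * c 0 * z)) (at 0)"
      by (rule DERIV_chain2[OF df dc])
    moreover have "(c has_field_derivative \<i>) (at 0)"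
      unfolding c_def by (auto intro!: derivative_eq_intros)
    ultimately show "(\<psi>' has_field_derivative 1 + z * deriv (deriv f) z / deriv f z)
        (at (of_real 0))"
      unfolding \<psi>'_def using f'
      by (auto intro!: derivative_eq_intros simp: field_simps c_def)
  qed
  from DERIV_neg_dec_right[OF d2 neg] obtain e where e: "e > 0"
    "\<And>h. 0 < h \<Longrightarrow> h < e \<Longrightarrow> Re (\<psi>' (of_real h)) < Re (\<psi>' 0)"
    by auto
  have "\<psi>' 0 = - \<i>" using f' by (simp add: \<psi>'_def c_def)
  with e(2) have neg': "Re (\<psi>' (of_real h)) < 0" if "0 < h" "h < e" for h
    using that by simp
  have "Re (\<psi> (of_real (e / 2))) < Re (\<psi> (of_real 0))"
  proof (rule DERIV_neg_imp_decreasing_open[where f = "\<lambda>t. Re (\<psi> (of_real t))"])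
    show "0 < e / 2" using e(1) by simp
    show "continuous_on {0..e / 2} (\<lambda>t. Re (\<psi> (of_real t)))"
      using d1 by (intro DERIV_atLeastAtMost_imp_continuous_on) blast
    fix t assume "0 < t" "t < e / 2"
    with d1[of t] neg'[of t]
    show "\<exists>y. ((\<lambda>t. Re (\<psi> (of_real t))) has_real_derivative y) (at t) \<and> y < 0"
      by auto
  qed
  moreover have "\<psi> 0 = 0" by (simp add: \<psi>_def c_def)
  moreover have "Re (\<psi> (of_real (e / 2))) \<ge> 0"
    unfolding \<psi>_def using Re_chord_quotient_nonneg[OF holf inj conv z, of "c (of_real (e / 2))"]
    by (simp add: c_def)
  ultimately show False by simp
qed

lemma Re_convexity_quotient_pos:
  assumes holf: "f holomorphic_on unit_disc" and inj: "inj_on f unit_disc"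
    and conv: "convex (f ` unit_disc)" and z: "norm z < 1"
  shows "Re (1 + z * deriv (deriv f) z / deriv f z) > 0"
proof -
  let ?p = "\<lambda>z. 1 + z * deriv (deriv f) z / deriv f z"
  have hol: "deriv f holomorphic_on unit_disc" "deriv (deriv f) holomorphic_on unit_disc"
    using holf by (simp_all add: holomorphic_deriv)
  have nz: "deriv f w \<noteq> 0" if "w \<in> unit_disc" for w
    by (rule holomorphic_injective_imp_regular[OF holf open_ball inj that])
  have holp: "?p holomorphic_on unit_disc"
    by (intro holomorphic_on_add holomorphic_on_divide holomorphic_on_mult hol nz
        holomorphic_on_const holomorphic_on_ident)
  have nonneg: "Re (?p w) \<ge> 0" if "w \<in> unit_disc" for w
    by (rule Re_convexity_quotient_nonneg[OF holf inj conv]) (use that in simp)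
  have p0: "Re (?p 0) > 0" by simp
  show ?thesis
    by (rule Re_pos_if_Re_nonneg[OF holp open_ball connected_ball nonneg _ p0])
      (use z in simp_all)
qed

section \<open>Univalence of the combination\<close>

text \<open>
  The real part of \<open>\<alpha> / (1 - \<alpha>)\<close> has the sign of \<open>Re (\<alpha> (1 - cnj \<alpha>)) = Re \<alpha> - \<bar>\<alpha>\<bar>\<^sup>2\<close>, and
  \<open>\<bar>2\<alpha> - 1\<bar>\<^sup>2 - 1 = 4 (\<bar>\<alpha>\<bar>\<^sup>2 - Re \<alpha>)\<close>.
\<close>
lemma Re_ratio_nonneg:
  fixes \<alpha> :: complex
  assumes "norm (2 * \<alpha> - 1) \<le> 1"
  shows "Re (\<alpha> / (1 - \<alpha>)) \<ge> 0"
proof -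
  have "(norm (2 * \<alpha> - 1))\<^sup>2 \<le> 1"
    using assms by (simp add: abs_square_le_1)
  then have "(2 * Re \<alpha> - 1)\<^sup>2 + (2 * Im \<alpha>)\<^sup>2 \<le> 1"
    unfolding cmod_power2 by simp
  then have "(Re \<alpha>)\<^sup>2 + (Im \<alpha>)\<^sup>2 \<le> Re \<alpha>"
    by (simp add: power2_eq_square algebra_simps)
  then have "Re \<alpha> * (1 - Re \<alpha>) + Im \<alpha> * (- Im \<alpha>) \<ge> 0"
    by (simp add: power2_eq_square algebra_simps)
  then show ?thesis by (simp add: Re_divide)
qed

theorem theorem1:
  fixes \<alpha> :: complex and f :: "complex \<Rightarrow> complex"
  assumes "norm (2 * \<alpha> - 1) \<le> 1"
    and "f \<in> class_A"
    and "convex_function f"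
  shows "univalent_on (\<lambda>z. \<alpha> * f z + (1 - \<alpha>) * z * deriv f z) unit_disc"
proof -
  let ?F = "\<lambda>z. \<alpha> * f z + (1 - \<alpha>) * z * deriv f z"
  have holf: "f holomorphic_on unit_disc" and inj: "inj_on f unit_disc"
    and conv: "convex (f ` unit_disc)"
    using assms(3) by (auto simp: convex_function_def univalent_on_def analytic_on_open)
  have hol': "deriv f holomorphic_on unit_disc"
    using holf by (simp add: holomorphic_deriv)
  have holF: "?F holomorphic_on unit_disc"
    using holf hol' by (intro holomorphic_intros) auto
  have "inj_on ?F unit_disc"
  proof (cases "\<alpha> = 1")
    case True
    then show ?thesis using inj by simp
  next
    case False
    have "inj_on (\<lambda>z. ?F z / (1 - \<alpha>)) unit_disc"
    proof (rule inj_on_if_Re_deriv_quotient_pos[OF holf _ open_ball inj conv])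
      show "(\<lambda>z. ?F z / (1 - \<alpha>)) holomorphic_on unit_disc"
        using holF False by (intro holomorphic_on_divide holomorphic_on_const) auto
      fix z :: complex assume z: "z \<in> unit_disc"
      have f': "deriv f z \<noteq> 0"
        using holomorphic_injective_imp_regular[OF holf open_ball inj] z by simp
      have "(f has_field_derivative deriv f z) (at z)"
        "(deriv f has_field_derivative deriv (deriv f) z) (at z)"
        using holf hol' z by (auto intro: holomorphic_derivI)
      then have "(?F has_field_derivative
          \<alpha> * deriv f z + (1 - \<alpha>) * (deriv f z + z * deriv (deriv f) z)) (at z)"
        by (auto intro!: derivative_eq_intros simp: algebra_simps)
      from DERIV_imp_deriv[OF DERIV_cdivide[OF this, of "1 - \<alpha>"]]
      have "deriv (\<lambda>z. ?F z / (1 - \<alpha>)) z / deriv f z =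
          \<alpha> / (1 - \<alpha>) + (1 + z * deriv (deriv f) z / deriv f z)"
        using f' False by (simp add: divide_simps)
      moreover have "Re (\<alpha> / (1 - \<alpha>)) + Re (1 + z * deriv (deriv f) z / deriv f z) > 0"
        using z by (intro add_nonneg_pos Re_ratio_nonneg[OF assms(1)]
            Re_convexity_quotient_pos[OF holf inj conv]) simp
      ultimately show "Re (deriv (\<lambda>z. ?F z / (1 - \<alpha>)) z / deriv f z) > 0"
        by (simp only: plus_complex.sel)
    qed
    then show ?thesis using False by (auto simp: inj_on_def)
  qed
  with holF show ?thesis by (simp add: univalent_on_def analytic_on_open)
qed

end
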